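(* For each integer $n\ge 0$, let $RR_1(n)$ denote the number of partitions of $n$ in which the difference between any two parts is at least $2$, and let $\overline{RR^*_1}(n)$ denote the number of overpartitions of $n$ in which the non-overlined parts are even and distinct, and every overlined part is at most one plus the number of non-overlined parts. Then $RR_1(n)=\overline{RR^*_1}(n)$ for every $n\ge 0$.
   Context: A partition of $n$ is a weakly decreasing finite sequence of positive integers (its parts) with sum $n$; parts at different positions count as different parts, so "difference at least $2$" excludes repeated parts. An overpartition of $n$ is a weakly decreasing finite sequence of positive integers with sum $n$ in which the last occurrence of a part of each given magnitude may or may not be overlined. Thus the overlined parts are automatically distinct from one another. "The non-overlined parts are distinct" means that they are pairwise distinct among themselves; an overlined and a non-overlined part may have the same magnitude. Conditions on parts of a given kind are vacuous if there are no such parts. There is exactly one partition and one overpartition of $0$ (the empty one). *)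

theory Defs
  imports Main
begin

definition is_partition :: "nat \<Rightarrow> nat list \<Rightarrow> bool" where
  "is_partition n xs \<longleftrightarrow>
     sorted_wrt (\<ge>) xs \<and> (\<forall>x \<in> set xs. 0 < x) \<and> sum_list xs = n"

(* sorted_wrt constrains all pairs of positions i < j; since parts weakly decrease,
   the difference of the two parts is the earlier one minus the later one. *)
definition RR1 :: "nat \<Rightarrow> nat" where
  "RR1 n = card {xs. is_partition n xs \<and> sorted_wrt (\<lambda>x y. x - y \<ge> 2) xs}"

(* An overpartition is encoded as a list of pairs (magnitude, overlined?).  The last conjunct
   says that a part may be overlined only at the last occurrence of its magnitude. *)
definition is_overpartition :: "nat \<Rightarrow> (nat \<times> bool) list \<Rightarrow> bool" where
  "is_overpartition n ps \<longleftrightarrow>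
     is_partition n (map fst ps) \<and>
     (\<forall>i j. i < j \<and> j < length ps \<and> snd (ps ! i) \<longrightarrow> fst (ps ! j) \<noteq> fst (ps ! i))"

definition overlined_parts :: "(nat \<times> bool) list \<Rightarrow> nat list" where
  "overlined_parts ps = map fst (filter snd ps)"

definition nonoverlined_parts :: "(nat \<times> bool) list \<Rightarrow> nat list" where
  "nonoverlined_parts ps = map fst (filter (\<lambda>p. \<not> snd p) ps)"

definition RR1_star_bar :: "nat \<Rightarrow> nat" where
  "RR1_star_bar n = card {ps. is_overpartition n ps \<and>
     (\<forall>x \<in> set (nonoverlined_parts ps). even x) \<and>
     distinct (nonoverlined_parts ps) \<and>
     (\<forall>x \<in> set (overlined_parts ps). x \<le> 1 + length (nonoverlined_parts ps))}"

(* card is 0 on infinite sets; the following facts show that the counts above are genuine. *)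

lemma length_le_sum_list: "\<forall>x \<in> set xs. 0 < x \<Longrightarrow> length xs \<le> sum_list (xs :: nat list)"
  by (induction xs) auto

lemma finite_partitions: "finite {xs. is_partition n xs}"
proof (rule finite_subset)
  show "{xs. is_partition n xs} \<subseteq> {xs. set xs \<subseteq> {..n} \<and> length xs \<le> n}"
    using length_le_sum_list by (auto simp: is_partition_def member_le_sum_list)
  show "finite {xs. set xs \<subseteq> {..n} \<and> length xs \<le> n}"
    by (rule finite_lists_length_le) simp
qed

lemma finite_overpartitions: "finite {ps. is_overpartition n ps}"
proof (rule finite_subset)
  show "{ps. is_overpartition n ps} \<subseteq> {ps. set ps \<subseteq> {..n} \<times> UNIV \<and> length ps \<le> n}"
  proof (clarsimp, intro conjI subsetI)
    fix ps assume "is_overpartition n ps"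
    then have p: "is_partition n (map fst ps)"
      by (simp add: is_overpartition_def)
    show "length ps \<le> n"
      using p length_le_sum_list[of "map fst ps"] by (simp add: is_partition_def)
    fix x assume "x \<in> set ps"
    then have "fst x \<in> set (map fst ps)"
      by simp
    then have "fst x \<le> n"
      using p member_le_sum_list[of "fst x" "map fst ps"] by (simp add: is_partition_def)
    then show "x \<in> {..n} \<times> UNIV"
      by (cases x) auto
  qed
  show "finite {ps. set ps \<subseteq> {..n} \<times> (UNIV :: bool set) \<and> length ps \<le> n}"
    by (rule finite_lists_length_le) simp
qed

end

theory Submission
  imports Defs
begin

text \<open>
  An overpartition counted on the right is a pair \<open>(es, A)\<close>: the strictly decreasing list
  \<open>e\<^sub>1 > \<dots> > e\<^sub>m\<close> of its even non-overlined parts, and the set \<open>A \<subseteq> {1..m+1}\<close> of its overlined parts.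
  Regard \<open>A\<close> as a partition into distinct parts and add its conjugate to \<open>es\<close>, that is, put
  \<open>p\<^sub>j = e\<^sub>j + #{o \<in> A. o \<ge> j}\<close> for \<open>1 \<le> j \<le> m+1\<close>, where \<open>e\<^sub>m\<^sub>+\<^sub>1 = 0\<close>, and drop \<open>p\<^sub>m\<^sub>+\<^sub>1\<close> if it is zero.
  Conjugation preserves the sum, so \<open>p\<close> has the size of the overpartition. Gaps of \<open>es\<close> (including
  the one below \<open>e\<^sub>m\<close>) are even and positive, hence at least \<open>2\<close>, and gaps do not shrink when the
  conjugate is added, so \<open>p\<close> is a Rogers-Ramanujan partition; the only part that may equal \<open>1\<close> is
  \<open>p\<^sub>m\<^sub>+\<^sub>1\<close>, in which case all other parts have grown by at least \<open>1\<close> as well.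

  The map can be undone because the conjugate of a set of distinct parts has gaps \<open>0\<close> and \<open>1\<close>, and
  \<open>j \<in> A\<close> exactly if the gap at \<open>j\<close> is \<open>1\<close>. As the \<open>e\<^sub>j\<close> are even, this happens exactly if
  \<open>p\<^sub>j - p\<^sub>j\<^sub>+\<^sub>1\<close> is odd, so the parities of the gaps of \<open>p\<close> recover \<open>A\<close>, and then \<open>es\<close>.

  Both halves of bijectivity are inductions on the list, removing the largest part:
  \<open>add_conjugate_inject\<close> and \<open>add_conjugate_surj\<close>. The passage from overpartitions to pairs
  \<open>(es, A)\<close> is \<open>bij_betw_star_pairs\<close>.
\<close>

section \<open>Strictly decreasing lists and their sets\<close>

lemma sorted_by_key_set_inject:
  fixes key :: "'a \<Rightarrow> nat"
  assumes "inj key" "sorted_wrt (\<lambda>x y. key y < key x) xs" "sorted_wrt (\<lambda>x y. key y < key x) ys"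
    and "set xs = set ys"
  shows "xs = ys"
proof -
  have "rev (map key xs) = rev (map key ys)"
    by (rule strict_sorted_equal) (use assms in \<open>simp_all add: sorted_wrt_rev sorted_wrt_map\<close>)
  then show ?thesis
    using assms(1) by (simp add: inj_map_eq_map)
qed

lemma sorted_by_key_exists:
  fixes key :: "'a \<Rightarrow> nat"
  assumes "inj key" "finite S"
  obtains xs where "sorted_wrt (\<lambda>x y. key y < key x) xs" "set xs = S"
proof
  let ?xs = "map (inv key) (rev (sorted_list_of_set (key ` S)))"
  show "set ?xs = S"
    using assms by (simp add: image_image)
  have "sorted_wrt (\<lambda>x y. y < x) (rev (sorted_list_of_set (key ` S)))"
    by (simp add: sorted_wrt_rev)
  then show "sorted_wrt (\<lambda>x y. key y < key x) ?xs"
    unfolding sorted_wrt_map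
    by (rule sorted_wrt_mono_rel[rotated]) (use assms in auto)
qed

section \<open>Adding the conjugate of a set of distinct parts\<close>

definition RR_list :: "nat list \<Rightarrow> bool" where
  "RR_list xs \<longleftrightarrow> (\<forall>x \<in> set xs. 0 < x) \<and> sorted_wrt (\<lambda>x y. x - y \<ge> 2) xs"

definition star_pair :: "nat list \<Rightarrow> nat set \<Rightarrow> bool" where
  "star_pair es A \<longleftrightarrow> sorted_wrt (>) es \<and> (\<forall>e \<in> set es. 0 < e \<and> even e) \<and> A \<subseteq> {1..Suc (length es)}"

definition largest_part :: "nat list \<Rightarrow> nat" where
  "largest_part xs = (case xs of [] \<Rightarrow> 0 | x # _ \<Rightarrow> x)"

lemma largest_part_simps [simp]: "largest_part [] = 0" "largest_part (x # xs) = x"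
  by (simp_all add: largest_part_def)

text \<open>On the conjugate of \<open>A\<close>, this removes the largest part, which is \<open>card A\<close>.\<close>

definition lower :: "nat set \<Rightarrow> nat set" where
  "lower A = {i. 0 < i \<and> Suc i \<in> A}"

text \<open>The empty list stands for \<open>e\<^sub>m\<^sub>+\<^sub>1 = 0\<close>; there, the conjugate has at most one part left.\<close>

fun add_conjugate :: "nat list \<Rightarrow> nat set \<Rightarrow> nat list" where
  "add_conjugate [] A = (if 1 \<in> A then [1] else [])"
| "add_conjugate (e # es) A = (e + card A) # add_conjugate es (lower A)"

lemma RR_list_Cons:
  "RR_list (x # xs) \<longleftrightarrow> RR_list xs \<and> 0 < x \<and> (xs \<noteq> [] \<longrightarrow> largest_part xs + 2 \<le> x)"
  by (cases xs) (auto simp: RR_list_def)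

lemma star_pair_Cons:
  "star_pair (e # es) A \<longleftrightarrow>
     star_pair es (lower A) \<and> even e \<and> largest_part es < e \<and> A \<subseteq> {1..Suc (Suc (length es))}"
proof -
  have "lower A \<subseteq> {1..Suc (length es)}" if "A \<subseteq> {1..Suc (Suc (length es))}"
    using that by (auto simp: lower_def)
  then show ?thesis
    by (cases es) (auto simp: star_pair_def)
qed

lemma lower_decomposition:
  assumes "0 \<notin> A"
  shows "A = Suc ` lower A \<union> (if 1 \<in> A then {1} else {})"
proof -
  have "x \<in> Suc ` lower A" if "x \<in> A" "x \<noteq> 1" for x
    using that assms by (cases x) (auto simp: lower_def)
  then show ?thesis
    by (auto simp: lower_def)
qed

lemma star_pair_finite: "star_pair es A \<Longrightarrow> finite A"
  by (auto simp: star_pair_def intro: finite_subset)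

lemma star_pair_zero: "star_pair es A \<Longrightarrow> 0 \<notin> A"
  by (auto simp: star_pair_def)

lemma card_lower:
  assumes "0 \<notin> A" "finite A"
  shows "card A = card (lower A) + (if 1 \<in> A then 1 else 0)"
proof -
  let ?B = "if 1 \<in> A then {1} else {} :: nat set"
  have fin: "finite (lower A)"
    using assms(2) by (auto simp: lower_def intro: finite_subset[OF _ finite_vimageI[of A Suc]])
  have "card A = card (Suc ` lower A \<union> ?B)"
    by (rule arg_cong[OF lower_decomposition[OF assms(1)]])
  also have "\<dots> = card (Suc ` lower A) + card ?B"
    by (rule card_Un_disjoint) (use fin in \<open>auto simp: lower_def\<close>)
  finally show ?thesis
    by (simp add: card_image split: if_splits)
qed

text \<open>
  Each part loses \<open>1\<close>, and a part equal to \<open>1\<close> thereby disappears. This is what makes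
  \<open>add_conjugate\<close> preserve the size.
\<close>

lemma sum_lower:
  assumes "0 \<notin> A" "finite A"
  shows "\<Sum>A = \<Sum>(lower A) + card A"
proof -
  let ?B = "if 1 \<in> A then {1} else {} :: nat set"
  have fin: "finite (lower A)"
    using assms(2) by (auto simp: lower_def intro: finite_subset[OF _ finite_vimageI[of A Suc]])
  have "\<Sum>A = \<Sum>(Suc ` lower A \<union> ?B)"
    by (rule arg_cong[OF lower_decomposition[OF assms(1)]])
  also have "\<dots> = \<Sum>(Suc ` lower A) + \<Sum>?B"
    by (rule sum.union_disjoint) (use fin in \<open>auto simp: lower_def\<close>)
  also have "\<Sum>(Suc ` lower A) = \<Sum>(lower A) + card (lower A)"
    by (simp add: sum.reindex sum_Suc)
  finally show ?thesis
    using card_lower[OF assms] by simp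
qed

lemma star_pair_Nil: "star_pair [] A \<longleftrightarrow> A = {} \<or> A = {1}"
  by (auto simp: star_pair_def subset_singleton_iff)

lemma sum_add_conjugate:
  "star_pair es A \<Longrightarrow> sum_list (add_conjugate es A) = sum_list es + \<Sum>A"
proof (induction es arbitrary: A)
  case Nil
  then show ?case by (auto simp: star_pair_Nil)
next
  case (Cons e es)
  then show ?case
    using sum_lower[OF star_pair_zero star_pair_finite, OF Cons.prems Cons.prems]
    by (simp add: star_pair_Cons)
qed

lemma largest_part_add_conjugate:
  "star_pair es A \<Longrightarrow> largest_part (add_conjugate es A) = largest_part es + card A"
  by (cases es) (auto simp: star_pair_Nil)

lemma even_largest_part: "star_pair es A \<Longrightarrow> even (largest_part es)"
  by (cases es) (auto simp: star_pair_def)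

lemma star_pair_Cons_ge_2: "star_pair (e # es) A \<Longrightarrow> 2 \<le> e"
  by (cases "e = 1") (auto simp: star_pair_def)

lemma RR_list_add_conjugate:
  "star_pair es A \<Longrightarrow> RR_list (add_conjugate es A)"
proof (induction es arbitrary: A)
  case Nil
  then show ?case by (auto simp: RR_list_def)
next
  case (Cons e es)
  from Cons.prems have sp: "star_pair es (lower A)" and e: "even e" "largest_part es < e"
    by (auto simp: star_pair_Cons)
  \<comment> \<open>Both numbers are even, and for empty \<open>es\<close> the smaller one is \<open>0\<close>.\<close>
  have "largest_part es + 2 \<le> e"
    using e even_largest_part[OF sp] by presburger
  moreover have "card (lower A) \<le> card A"
    using card_lower[OF star_pair_zero star_pair_finite, OF Cons.prems Cons.prems] by simp
  ultimately show ?case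
    using Cons.IH[OF sp] largest_part_add_conjugate[OF sp] by (simp add: RR_list_Cons)
qed

text \<open>
  Two preimages of the same list have the same tails by induction. Their sets can then differ
  only in whether they contain \<open>1\<close>, and this would change the parity of the first part.
\<close>

lemma add_conjugate_inject:
  assumes "star_pair es A" "star_pair fs Q" "add_conjugate es A = add_conjugate fs Q"
  shows "es = fs \<and> A = Q"
  using assms
proof (induction es arbitrary: A fs Q)
  case Nil
  then show ?case
    by (cases fs) (auto simp: star_pair_Nil dest: star_pair_Cons_ge_2 split: if_splits)
next
  case (Cons e es)
  note spA = Cons.prems(1)
  note spQ = Cons.prems(2)
  show ?case
  proof (cases fs)
    case Nil
    with Cons.prems show ?thesis
      by (auto simp: star_pair_Nil dest: star_pair_Cons_ge_2 split: if_splits)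
  next
    case fs: (Cons f fs')
    have "es = fs' \<and> lower A = lower Q"
      by (rule Cons.IH) (use Cons.prems fs in \<open>auto simp: star_pair_Cons\<close>)
    then have tail: "es = fs'" "lower A = lower Q"
      by auto
    have head: "e + card A = f + card Q" and ev: "even e" "even f"
      using Cons.prems fs by (auto simp: star_pair_Cons)
    have cA: "card A = card (lower A) + (if 1 \<in> A then 1 else 0)"
      by (rule card_lower[OF star_pair_zero star_pair_finite, OF spA spA])
    have cQ: "card Q = card (lower Q) + (if 1 \<in> Q then 1 else 0)"
      by (rule card_lower[OF star_pair_zero star_pair_finite, OF spQ spQ])
    have "even (card A) = even (card Q)"
      using head ev by presburger
    then have one: "1 \<in> A \<longleftrightarrow> 1 \<in> Q"
      using cA cQ tail(2) by (auto split: if_splits)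
    have "A = Q"
      using lower_decomposition[OF star_pair_zero[OF spA]]
        lower_decomposition[OF star_pair_zero[OF spQ]] tail(2) one by auto
    with head tail fs show ?thesis
      by simp
  qed
qed

text \<open>
  To prepend a part \<open>x\<close>, the parts of the set grow by one, and \<open>1\<close> is added to it exactly if that is
  needed to make \<open>e\<close> even. As \<open>card A\<close> grows by at most \<open>1\<close>, the gap of at least \<open>2\<close> below \<open>x\<close>
  leaves \<open>e\<close> larger than the next even part. Only \<open>x = 1\<close> is exceptional: it comes from no even
  part at all.
\<close>

lemma add_conjugate_surj:
  assumes "RR_list xs"
  shows "\<exists>es A. star_pair es A \<and> add_conjugate es A = xs"
  using assms
proof (induction xs)
  case Nil
  have "star_pair [] {} \<and> add_conjugate [] {} = []"
    by (simp add: star_pair_Nil)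
  then show ?case by blast
next
  case (Cons x xs)
  show ?case
  proof (cases "x = 1")
    case True
    with Cons.prems have "xs = []"
      by (auto simp: RR_list_Cons)
    with True have "star_pair [] {1} \<and> add_conjugate [] {1} = x # xs"
      by (simp add: star_pair_Nil)
    then show ?thesis by blast
  next
    case False
    from Cons obtain es Q where sp: "star_pair es Q" and xs: "add_conjugate es Q = xs"
      by (auto simp: RR_list_Cons)
    have gap: "largest_part es + card Q + 2 \<le> x"
      using Cons.prems False largest_part_add_conjugate[OF sp] xs
      by (cases "xs = []") (auto simp: RR_list_Cons)
    define A where "A = Suc ` Q \<union> (if odd (x + card Q) then {1} else {})"
    have zero: "0 \<notin> Q" and fin: "finite Q"
      using star_pair_zero[OF sp] star_pair_finite[OF sp] by auto
    have low: "lower A = Q"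
      using zero by (auto simp: lower_def A_def intro: Suc_lessI gr0I)
    have one: "1 \<in> A \<longleftrightarrow> odd (x + card Q)"
      using zero by (auto simp: A_def)
    have card: "card A = card Q + (if odd (x + card Q) then 1 else 0)"
      using card_lower[of A] one low fin by (auto simp: A_def)
    define e where "e = x - card A"
    have "star_pair (e # es) A"
    proof -
      have "A \<subseteq> {1..Suc (Suc (length es))}"
        using sp by (auto simp: A_def star_pair_def)
      moreover have "even e" "largest_part es < e"
        using gap card by (auto simp: e_def)
      ultimately show ?thesis
        using sp low by (simp add: star_pair_Cons)
    qed
    moreover have "add_conjugate (e # es) A = x # xs"
      using gap card xs low by (simp add: e_def)
    ultimately show ?thesis by blast
  qed
qed

section \<open>Overpartitions as pairs\<close>

text \<open>
  A numbering of the possible parts in which, among parts of equal magnitude, the overlined one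
  comes last in decreasing order.
\<close>

definition rank :: "nat \<times> bool \<Rightarrow> nat" where
  "rank p = 2 * fst p + (if snd p then 0 else 1)"

lemma rank_less_iff:
  "rank q < rank p \<longleftrightarrow> fst q < fst p \<or> fst q = fst p \<and> snd q \<and> \<not> snd p"
  by (auto simp: rank_def)

lemma inj_rank: "inj rank"
proof (rule injI)
  fix p q :: "nat \<times> bool"
  assume "rank p = rank q"
  then have "fst p = fst q \<and> snd p = snd q"
    unfolding rank_def by (cases "snd p"; cases "snd q"; simp; presburger)
  then show "p = q"
    by (simp add: prod_eq_iff)
qed

lemma overpartition_parts_simps [simp]:
  "nonoverlined_parts [] = []"
  "overlined_parts [] = []"
  "nonoverlined_parts (p # ps) = (if snd p then [] else [fst p]) @ nonoverlined_parts ps"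
  "overlined_parts (p # ps) = (if snd p then [fst p] else []) @ overlined_parts ps"
  by (auto simp: nonoverlined_parts_def overlined_parts_def)

lemma set_overpartition_parts:
  "set (nonoverlined_parts ps) = {x. (x, False) \<in> set ps}"
  "set (overlined_parts ps) = {x. (x, True) \<in> set ps}"
  by (force simp: nonoverlined_parts_def overlined_parts_def)+

text \<open>
  With distinct non-overlined parts, no pair can repeat, so the weak order together with the
  rule for overlining becomes a single strict order.
\<close>

lemma is_overpartition_iff_rank:
  "is_overpartition n ps \<and> distinct (nonoverlined_parts ps) \<longleftrightarrow>
   sorted_wrt (\<lambda>p q. rank q < rank p) ps \<and> (\<forall>x \<in> fst ` set ps. 0 < x) \<and> sum_list (map fst ps) = n"
proof -
  have last: "(\<forall>i j. i < j \<and> j < length ps \<and> snd (ps ! i) \<longrightarrow> fst (ps ! j) \<noteq> fst (ps ! i)) \<longleftrightarrow>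
      sorted_wrt (\<lambda>p q. snd p \<longrightarrow> fst q \<noteq> fst p) ps"
    unfolding sorted_wrt_iff_nth_less by blast
  have "sorted_wrt (\<lambda>p q. fst q \<le> fst p) ps \<and> sorted_wrt (\<lambda>p q. snd p \<longrightarrow> fst q \<noteq> fst p) ps \<and>
      distinct (nonoverlined_parts ps) \<longleftrightarrow> sorted_wrt (\<lambda>p q. rank q < rank p) ps"
  proof (induction ps)
    case (Cons p ps)
    have "rank q < rank p \<longleftrightarrow>
        fst q \<le> fst p \<and> (snd p \<longrightarrow> fst q \<noteq> fst p) \<and> (\<not> snd p \<longrightarrow> q \<noteq> (fst p, False))" for q
      by (cases q) (auto simp: rank_less_iff)
    then have "(\<forall>q \<in> set ps. rank q < rank p) \<longleftrightarrow>
        (\<forall>q \<in> set ps. fst q \<le> fst p) \<and> (\<forall>q \<in> set ps. snd p \<longrightarrow> fst q \<noteq> fst p) \<and>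
        (\<not> snd p \<longrightarrow> fst p \<notin> set (nonoverlined_parts ps))"
      by (auto simp: set_overpartition_parts)
    with Cons show ?case
      by auto
  qed simp
  with last show ?thesis
    unfolding is_overpartition_def is_partition_def sorted_wrt_map by auto
qed

lemma sorted_overpartition_parts:
  assumes "sorted_wrt (\<lambda>p q. rank q < rank p) ps"
  shows "sorted_wrt (>) (nonoverlined_parts ps)" "sorted_wrt (>) (overlined_parts ps)"
  using assms
  by (induction ps) (auto simp: rank_less_iff set_overpartition_parts)

lemma sum_overpartition_parts:
  assumes "sorted_wrt (\<lambda>p q. rank q < rank p) ps"
  shows "sum_list (map fst ps) = sum_list (nonoverlined_parts ps) + \<Sum>(set (overlined_parts ps))"
proof -
  have "sum_list (map fst ps) = sum_list (nonoverlined_parts ps) + sum_list (overlined_parts ps)"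
    by (induction ps) auto
  moreover have "distinct (overlined_parts ps)"
    using sorted_overpartition_parts(2)[OF assms]
    by (simp add: distinct_conv_nth sorted_wrt_iff_nth_less) (metis less_irrefl nat_neq_iff)
  ultimately show ?thesis
    using sum.distinct_set_conv_list[of "overlined_parts ps" "\<lambda>x. x"] by simp
qed

definition star_overpartitions :: "nat \<Rightarrow> (nat \<times> bool) list set" where
  "star_overpartitions n = {ps. is_overpartition n ps \<and>
     (\<forall>x \<in> set (nonoverlined_parts ps). even x) \<and>
     distinct (nonoverlined_parts ps) \<and>
     (\<forall>x \<in> set (overlined_parts ps). x \<le> 1 + length (nonoverlined_parts ps))}"

lemma star_overpartitions_iff:
  "ps \<in> star_overpartitions n \<longleftrightarrow>
     sorted_wrt (\<lambda>p q. rank q < rank p) ps \<and>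
     star_pair (nonoverlined_parts ps) (set (overlined_parts ps)) \<and>
     sum_list (nonoverlined_parts ps) + \<Sum>(set (overlined_parts ps)) = n"
proof -
  have pos: "(\<forall>x \<in> fst ` set ps. 0 < x) \<longleftrightarrow>
      (\<forall>x \<in> set (nonoverlined_parts ps). 0 < x) \<and> (\<forall>x \<in> set (overlined_parts ps). 0 < x)"
  proof -
    have "fst ` set ps = set (nonoverlined_parts ps) \<union> set (overlined_parts ps)"
      by (induction ps) auto
    then show ?thesis
      by (simp add: ball_Un)
  qed
  have "ps \<in> star_overpartitions n \<longleftrightarrow>
      (is_overpartition n ps \<and> distinct (nonoverlined_parts ps)) \<and>
      (\<forall>x \<in> set (nonoverlined_parts ps). even x) \<and>
      (\<forall>x \<in> set (overlined_parts ps). x \<le> 1 + length (nonoverlined_parts ps))"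
    by (auto simp: star_overpartitions_def)
  also have "\<dots> \<longleftrightarrow> sorted_wrt (\<lambda>p q. rank q < rank p) ps \<and>
      star_pair (nonoverlined_parts ps) (set (overlined_parts ps)) \<and> sum_list (map fst ps) = n"
    unfolding is_overpartition_iff_rank pos star_pair_def
    using sorted_overpartition_parts(1)[of ps] by (simp add: subset_iff Suc_le_eq) blast
  finally show ?thesis
    using sum_overpartition_parts[of ps] by metis
qed

text \<open>
  The two kinds of parts determine the set of pairs, and a set of pairs has only one arrangement
  by decreasing rank; conversely any \<open>(es, A)\<close> is realised by arranging the disjoint union of
  \<open>set es\<close> and \<open>A\<close> in this way.
\<close>

lemma bij_betw_star_pairs:
  "bij_betw (\<lambda>ps. (nonoverlined_parts ps, set (overlined_parts ps)))
     (star_overpartitions n) {(es, A). star_pair es A \<and> sum_list es + \<Sum>A = n}"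
  unfolding bij_betw_def
proof
  show "inj_on (\<lambda>ps. (nonoverlined_parts ps, set (overlined_parts ps))) (star_overpartitions n)"
  proof (rule inj_onI)
    fix ps qs
    assume ps: "ps \<in> star_overpartitions n" and qs: "qs \<in> star_overpartitions n"
      and eq: "(nonoverlined_parts ps, set (overlined_parts ps)) =
        (nonoverlined_parts qs, set (overlined_parts qs))"
    have parts: "set rs = set (nonoverlined_parts rs) \<times> {False} \<union> set (overlined_parts rs) \<times> {True}"
      for rs
    proof (rule set_eqI)
      fix p :: "nat \<times> bool"
      show "p \<in> set rs \<longleftrightarrow>
          p \<in> set (nonoverlined_parts rs) \<times> {False} \<union> set (overlined_parts rs) \<times> {True}"
        by (cases p; cases "snd p") (auto simp: set_overpartition_parts)
    qed
    have "set ps = set qs"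
      using parts[of ps] parts[of qs] eq by simp
    with ps qs show "ps = qs"
      by (intro sorted_by_key_set_inject[OF inj_rank]) (auto simp: star_overpartitions_iff)
  qed
next
  show "(\<lambda>ps. (nonoverlined_parts ps, set (overlined_parts ps))) ` star_overpartitions n =
      {(es, A). star_pair es A \<and> sum_list es + \<Sum>A = n}" (is "?f ` _ = ?P")
  proof
    show "?f ` star_overpartitions n \<subseteq> ?P"
      by (rule image_subsetI) (simp add: star_overpartitions_iff)
    show "?P \<subseteq> ?f ` star_overpartitions n"
    proof (rule subsetI, clarify)
      fix es A
      assume sp: "star_pair es A" and sum: "n = sum_list es + \<Sum>A"
      have "finite (set es \<times> {False} \<union> A \<times> {True})"
        using star_pair_finite[OF sp] by simp
      then obtain ps where ps: "sorted_wrt (\<lambda>p q. rank q < rank p) ps"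
        and set: "set ps = set es \<times> {False} \<union> A \<times> {True}"
        by (rule sorted_by_key_exists[OF inj_rank])
      have non: "nonoverlined_parts ps = es"
      proof (rule sorted_by_key_set_inject[of "\<lambda>x. x"])
        show "sorted_wrt (>) es"
          using sp by (simp add: star_pair_def)
        show "sorted_wrt (>) (nonoverlined_parts ps)"
          using ps by (rule sorted_overpartition_parts)
        show "set (nonoverlined_parts ps) = set es"
          by (auto simp: set_overpartition_parts set)
      qed simp
      have over: "set (overlined_parts ps) = A"
        by (auto simp: set_overpartition_parts set)
      have "ps \<in> star_overpartitions (sum_list es + \<Sum>A)"
        unfolding star_overpartitions_iff non over using ps sp by simp
      then show "(es, A) \<in> ?f ` star_overpartitions (sum_list es + \<Sum>A)"
        using non over by (intro image_eqI[of _ _ ps]) simp_all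
    qed
  qed
qed

section \<open>Equality of the counts\<close>

lemma bij_betw_add_conjugate:
  "bij_betw (\<lambda>(es, A). add_conjugate es A)
     {(es, A). star_pair es A \<and> sum_list es + \<Sum>A = n} {xs. RR_list xs \<and> sum_list xs = n}"
  unfolding bij_betw_def
proof
  show "inj_on (\<lambda>(es, A). add_conjugate es A) {(es, A). star_pair es A \<and> sum_list es + \<Sum>A = n}"
  proof (rule inj_onI, clarify)
    fix es fs A B
    assume "star_pair es A" "star_pair fs B" "add_conjugate es A = add_conjugate fs B"
    then show "es = fs \<and> A = B"
      by (rule add_conjugate_inject)
  qed
  have "\<exists>z \<in> {(es, A). star_pair es A \<and> sum_list es + \<Sum>A = n}.
      xs = (\<lambda>(es, A). add_conjugate es A) z"
    if xs: "RR_list xs" "sum_list xs = n" for xs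
  proof -
    obtain es A where "star_pair es A" "add_conjugate es A = xs"
      using add_conjugate_surj[OF xs(1)] by blast
    with sum_add_conjugate[of es A] xs(2) show ?thesis
      by auto
  qed
  then show "(\<lambda>(es, A). add_conjugate es A) ` {(es, A). star_pair es A \<and> sum_list es + \<Sum>A = n} =
      {xs. RR_list xs \<and> sum_list xs = n}"
    by (auto simp: RR_list_add_conjugate sum_add_conjugate)
qed

lemma RR_list_iff_is_partition:
  "RR_list xs \<and> sum_list xs = n \<longleftrightarrow> is_partition n xs \<and> sorted_wrt (\<lambda>x y. x - y \<ge> 2) xs"
proof -
  have "sorted_wrt (\<ge>) xs" if "sorted_wrt (\<lambda>x y. x - y \<ge> 2) xs"
    by (rule sorted_wrt_mono_rel[OF _ that]) simp
  then show ?thesis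
    by (auto simp: RR_list_def is_partition_def)
qed

theorem theorem3p3:
  fixes n :: nat
  shows "RR1 n = RR1_star_bar n"
proof -
  have "RR1_star_bar n = card {xs. RR_list xs \<and> sum_list xs = n}"
    using bij_betw_same_card[OF bij_betw_trans[OF bij_betw_star_pairs bij_betw_add_conjugate]]
    by (simp add: RR1_star_bar_def star_overpartitions_def)
  then show ?thesis
    by (simp add: RR1_def RR_list_iff_is_partition)
qed

end
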